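(* For any word $c$ in the letters $x_0,x_1$ and any $d\in\mathbb{K}\langle\langle x_0,x_1\rangle\rangle$: 1. $\emptyset\,\tilde\circ\, d=\emptyset$. 2. $(x_0c)\,\tilde\circ\, d=x_0(c\,\tilde\circ\, d)$. 3. $(x_1c)\,\tilde\circ\, d=x_1(c\,\tilde\circ\, d)+x_0\bigl(d\sqcup\!\sqcup(c\,\tilde\circ\, d)\bigr)$.
   Context: $\mathbb{K}$ is a field of characteristic zero. $\mathbb{K}\langle\langle x_0,x_1\rangle\rangle$ is the space of noncommutative formal series in $x_0,x_1$, with its usual ultrametric topology; it is an algebra for concatenation and for the shuffle product $\sqcup\!\sqcup$ (determined by $\emptyset\sqcup\!\sqcup w=w\sqcup\!\sqcup\emptyset=w$ and $au\sqcup\!\sqcup bv=a(u\sqcup\!\sqcup bv)+b(au\sqcup\!\sqcup v)$ for letters $a,b$ and words $u,v,w$, extended bilinearly and continuously). The empty word $\emptyset$ is the unit of both products. For $d\in\mathbb{K}\langle\langle x_0,x_1\rangle\rangle$, $\varphi_d$ is the continuous algebra map (for concatenation on the source and composition of endomorphisms on the target) from $\mathbb{K}\langle\langle x_0,x_1\rangle\rangle$ to $\mathrm{End}(\mathbb{K}\langle\langle x_0,x_1\rangle\rangle)$ such that, for all $X$, $$\varphi_d(x_0)(X)=x_0X,\qquad \varphi_d(x_1)(X)=x_1X+x_0(d\sqcup\!\sqcup X).$$ The composition is $c\circ d=\varphi_d(c)(\emptyset)+d$, and $c\,\tilde\circ\, d=c\circ d-d=\varphi_d(c)(\emptyset)$.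 *)

theory Defs
  imports Complex_Main "HOL-Library.Multiset"
begin

section \<open>Noncommutative formal series in two letters\<close>

datatype letter = X0 | X1

instance letter :: finite
proof
  have "(UNIV :: letter set) = {X0, X1}"
    using letter.exhaust by auto
  then show "finite (UNIV :: letter set)"
    by (metis finite.emptyI finite_insert)
qed

typedef 'k ncseries = "UNIV :: (letter list \<Rightarrow> 'k) set"
  morphisms coeff Abs_ncseries ..

setup_lifting type_definition_ncseries

lemma ncseries_eqI: "(\<And>w. coeff s w = coeff t w) \<Longrightarrow> s = t"
  by (simp add: coeff_inject[symmetric] fun_eq_iff)

lift_definition word :: "letter list \<Rightarrow> 'k::zero_neq_one ncseries"
  is "\<lambda>u w. if w = u then 1 else 0" .

lemma finite_splits: "finite {(u, v). u @ v = (w :: 'a list)}"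
proof (rule finite_subset)
  show "{(u, v). u @ v = w} \<subseteq> (\<lambda>k. (take k w, drop k w)) ` {..length w}"
  proof safe
    fix u v assume "w = u @ v"
    then show "(u, v) \<in> (\<lambda>k. (take k (u @ v), drop k (u @ v))) ` {..length (u @ v)}"
      by (intro image_eqI[of _ _ "length u"]) auto
  qed
qed simp

lemma splits_Nil: "{(u, v). u @ v = ([] :: 'a list)} = {([], [])}"
  by auto

text \<open>The ring multiplication is concatenation, extended to series; its unit is the empty word.\<close>

instantiation ncseries :: (field) ring_1
begin

lift_definition zero_ncseries :: "'a ncseries" is "\<lambda>w. 0" .
lift_definition plus_ncseries :: "'a ncseries \<Rightarrow> 'a ncseries \<Rightarrow> 'a ncseries"
  is "\<lambda>s t w. s w + t w" .
lift_definition minus_ncseries :: "'a ncseries \<Rightarrow> 'a ncseries \<Rightarrow> 'a ncseries"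
  is "\<lambda>s t w. s w - t w" .
lift_definition uminus_ncseries :: "'a ncseries \<Rightarrow> 'a ncseries" is "\<lambda>s w. - s w" .
lift_definition times_ncseries :: "'a ncseries \<Rightarrow> 'a ncseries \<Rightarrow> 'a ncseries"
  is "\<lambda>s t w. \<Sum>(u, v) \<in> {(u, v). u @ v = w}. s u * t v" .
definition one_ncseries :: "'a ncseries" where "one_ncseries = word []"

instance
proof
  fix a b c :: "'a ncseries"
  show "a + b + c = a + (b + c)" by transfer (simp add: fun_eq_iff)
  show "a + b = b + a" by transfer (simp add: fun_eq_iff)
  show "0 + a = a" by transfer simp
  show "- a + a = 0" by transfer simp
  show "a - b = a + - b" by transfer simp
  show "(a + b) * c = a * c + b * c"
    by transfer (simp add: fun_eq_iff sum.distrib[symmetric] algebra_simps case_prod_unfold)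
  show "a * (b + c) = a * b + a * c"
    by transfer (simp add: fun_eq_iff sum.distrib[symmetric] algebra_simps case_prod_unfold)
  show "(0 :: 'a ncseries) \<noteq> 1"
    unfolding one_ncseries_def by transfer (auto simp: fun_eq_iff)
  show "1 * a = a"
  proof (rule ncseries_eqI)
    fix w
    have "coeff (1 * a) w = (\<Sum>(u, v) \<in> {(u, v). u @ v = w}. if u = [] then coeff a v else 0)"
      unfolding one_ncseries_def
      by (simp add: times_ncseries.rep_eq word.rep_eq) (intro sum.cong, auto)
    also have "\<dots> = (\<Sum>(u, v) \<in> {([] :: letter list, w)}. if u = [] then coeff a v else 0)"
      by (rule sum.mono_neutral_right) (auto simp: finite_splits split: if_splits)
    finally show "coeff (1 * a) w = coeff a w" by simp
  qed
  show "a * 1 = a"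
  proof (rule ncseries_eqI)
    fix w
    have "coeff (a * 1) w = (\<Sum>(u, v) \<in> {(u, v). u @ v = w}. if v = [] then coeff a u else 0)"
      unfolding one_ncseries_def
      by (simp add: times_ncseries.rep_eq word.rep_eq) (intro sum.cong, auto)
    also have "\<dots> = (\<Sum>(u, v) \<in> {(w, [] :: letter list)}. if v = [] then coeff a u else 0)"
      by (rule sum.mono_neutral_right) (auto simp: finite_splits split: if_splits)
    finally show "coeff (a * 1) w = coeff a w" by simp
  qed
  show "a * b * c = a * (b * c)"
  proof (rule ncseries_eqI)
    fix w
    have "coeff (a * b * c) w = (\<Sum>p \<in> {(u, v). u @ v = w}. \<Sum>q \<in> {(x, y). x @ y = fst p}.
        coeff a (fst q) * coeff b (snd q) * coeff c (snd p))"
      by (simp add: times_ncseries.rep_eq case_prod_unfold sum_distrib_right)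
    also have "\<dots> = (\<Sum>(p, q) \<in> (SIGMA p:{(u, v). u @ v = w}. {(x, y). x @ y = fst p}).
        coeff a (fst q) * coeff b (snd q) * coeff c (snd p))"
      by (rule sum.Sigma) (auto simp: finite_splits)
    also have "\<dots> = (\<Sum>(p, q) \<in> (SIGMA p:{(u, v). u @ v = w}. {(x, y). x @ y = snd p}).
        coeff a (fst p) * (coeff b (fst q) * coeff c (snd q)))"
      by (rule sum.reindex_bij_witness[where
            j = "\<lambda>(p, q). ((fst q, snd q @ snd p), (snd q, snd p))" and
            i = "\<lambda>(p, q). ((fst p @ fst q, snd q), (fst p, fst q))"])
         (auto simp: mult.assoc)
    also have "\<dots> = (\<Sum>p \<in> {(u, v). u @ v = w}. \<Sum>q \<in> {(x, y). x @ y = snd p}.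
        coeff a (fst p) * (coeff b (fst q) * coeff c (snd q)))"
      by (rule sum.Sigma[symmetric]) (auto simp: finite_splits)
    also have "\<dots> = coeff (a * (b * c)) w"
      by (simp add: times_ncseries.rep_eq case_prod_unfold sum_distrib_left)
    finally show "coeff (a * b * c) w = coeff (a * (b * c)) w" .
  qed
qed

end

lift_definition ncscale :: "'k::field \<Rightarrow> 'k ncseries \<Rightarrow> 'k ncseries"
  is "\<lambda>r s w. r * s w" .

interpretation ncs: vector_space ncscale
  by standard (transfer; simp add: fun_eq_iff algebra_simps)+

abbreviation x0 :: "'k::zero_neq_one ncseries" where "x0 \<equiv> word [X0]"
abbreviation x1 :: "'k::zero_neq_one ncseries" where "x1 \<equiv> word [X1]"

text \<open>The ultrametric: series are close when they agree on all short words.\<close>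

instantiation ncseries :: (type) metric_space
begin

definition dist_ncseries :: "'a ncseries \<Rightarrow> 'a ncseries \<Rightarrow> real" where
  "dist_ncseries s t =
    (if s = t then 0
     else inverse (2 ^ (LEAST n. \<exists>w. length w = n \<and> coeff s w \<noteq> coeff t w)))"

definition uniformity_ncseries :: "('a ncseries \<times> 'a ncseries) filter" where
  "uniformity_ncseries = (INF e\<in>{0<..}. principal {(x, y). dist x y < e})"

definition open_ncseries :: "'a ncseries set \<Rightarrow> bool" where
  "open_ncseries U \<longleftrightarrow> (\<forall>x\<in>U. eventually (\<lambda>(x', y). x' = x \<longrightarrow> y \<in> U) uniformity)"

lemma dist_ncseries_less_iff:
  "dist s t < inverse (2 ^ n) \<longleftrightarrow> (\<forall>w. length w \<le> n \<longrightarrow> coeff s w = coeff t w)"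
proof (cases "s = t")
  case True
  then show ?thesis by (simp add: dist_ncseries_def)
next
  case False
  define m where "m = (LEAST n. \<exists>w. length w = n \<and> coeff s w \<noteq> coeff t w)"
  from False obtain w where "coeff s w \<noteq> coeff t w"
    using ncseries_eqI by blast
  then have ex: "\<exists>n w. length w = n \<and> coeff s w \<noteq> coeff t w" by blast
  from LeastI_ex[OF ex] obtain v where v: "length v = m" "coeff s v \<noteq> coeff t v"
    by (auto simp: m_def)
  have least: "m \<le> length w" if "coeff s w \<noteq> coeff t w" for w
    unfolding m_def using that by (intro Least_le) auto
  have "dist s t < inverse (2 ^ n) \<longleftrightarrow> n < m"
    using False by (simp add: dist_ncseries_def m_def[symmetric])
  also have "\<dots> \<longleftrightarrow> (\<forall>w. length w \<le> n \<longrightarrow> coeff s w = coeff t w)"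
    using v least by (metis leD le_trans not_le)
  finally show ?thesis .
qed

instance
proof
  show eq: "dist s t = 0 \<longleftrightarrow> s = t" for s t :: "'a ncseries"
    by (simp add: dist_ncseries_def)
  have nonneg: "dist s t \<ge> 0" for s t :: "'a ncseries"
    by (simp add: dist_ncseries_def)
  have sym: "dist s t = dist t s" for s t :: "'a ncseries"
  proof -
    have "(\<exists>w. length w = n \<and> coeff s w \<noteq> coeff t w) \<longleftrightarrow>
          (\<exists>w. length w = n \<and> coeff t w \<noteq> coeff s w)" for n
      by metis
    then show ?thesis by (auto simp: dist_ncseries_def)
  qed
  fix s t r :: "'a ncseries"
  show "dist s t \<le> dist s r + dist t r"
  proof (rule ccontr)
    assume "\<not> ?thesis"
    then have *: "dist s r + dist t r < dist s t" by simp
    then have "s \<noteq> t"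
      using nonneg[of s r] nonneg[of t r] eq[of s t] by auto
    then obtain m where m: "dist s t = inverse (2 ^ m)"
      by (simp add: dist_ncseries_def)
    have "dist s r < inverse (2 ^ m)" "dist t r < inverse (2 ^ m)"
      using * m nonneg[of s r] nonneg[of t r] by auto
    then have "dist s t < inverse (2 ^ m)"
      unfolding dist_ncseries_less_iff by simp
    with m show False by simp
  qed
qed (rule uniformity_ncseries_def open_ncseries_def)+

end


section \<open>Shuffle product\<close>

text \<open>
  The shuffles of two words, counted with multiplicity; HOL's \<open>shuffles\<close> is only a set
  and does not record the multiplicities.
\<close>

fun word_shuffle :: "'a list \<Rightarrow> 'a list \<Rightarrow> 'a list multiset" where
  "word_shuffle [] v = {#v#}"
| "word_shuffle u [] = {#u#}"
| "word_shuffle (a # u) (b # v) =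
    image_mset ((#) a) (word_shuffle u (b # v)) + image_mset ((#) b) (word_shuffle (a # u) v)"

lemma length_word_shuffle: "w \<in># word_shuffle u v \<Longrightarrow> length w = length u + length v"
  by (induction u v arbitrary: w rule: word_shuffle.induct) auto

lemma finite_word_shuffle: "finite {(u, v). w \<in># word_shuffle u (v :: letter list)}"
proof (rule finite_subset)
  let ?A = "{u :: letter list. set u \<subseteq> UNIV \<and> length u \<le> length w}"
  show "{(u, v). w \<in># word_shuffle u v} \<subseteq> ?A \<times> ?A"
    using length_word_shuffle by fastforce
  show "finite (?A \<times> ?A)"
    by (intro finite_cartesian_product finite_lists_length_le) auto
qed

text \<open>
  The bilinear and continuous extension to series: the sum is finite since a word \<open>w\<close> is a shuffle
  of only finitely many pairs of words.
\<close>

lift_definition shuffle :: "'k::field ncseries \<Rightarrow> 'k ncseries \<Rightarrow> 'k ncseries"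
  is "\<lambda>s t w. \<Sum>(u, v) \<in> {(u, v). w \<in># word_shuffle u v}.
        of_nat (count (word_shuffle u v) w) * (s u * t v)" .

lemma coeff_shuffle_word:
  "coeff (shuffle (word u) (word v) :: 'k::field ncseries) w = of_nat (count (word_shuffle u v) w)"
proof -
  have "coeff (shuffle (word u) (word v) :: 'k ncseries) w =
      (\<Sum>p \<in> {(u, v). w \<in># word_shuffle u v}.
        if p = (u, v) then of_nat (count (word_shuffle u v) w) else 0)"
    unfolding shuffle.rep_eq by (intro sum.cong) (auto simp: word.rep_eq split: if_splits)
  also have "\<dots> = of_nat (count (word_shuffle u v) w)"
    by (subst sum.delta) (auto simp: finite_word_shuffle not_in_iff)
  finally show ?thesis .
qed


section \<open>The composition products\<close>

text \<open>
  \<open>is_phi d \<Phi>\<close> says that \<open>\<Phi>\<close> is a continuous algebra map into the linear endomorphisms, with the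
  prescribed values on the two letters. Endomorphisms carry the topology of pointwise convergence;
  this is the weakest of the usual choices, and continuity is needed only for uniqueness.
\<close>

definition is_phi ::
  "'k::field ncseries \<Rightarrow> ('k ncseries \<Rightarrow> 'k ncseries \<Rightarrow> 'k ncseries) \<Rightarrow> bool" where
  "is_phi d \<Phi> \<longleftrightarrow>
    (\<forall>c. Vector_Spaces.linear ncscale ncscale (\<Phi> c)) \<and>
    (\<forall>X. Vector_Spaces.linear ncscale ncscale (\<lambda>c. \<Phi> c X)) \<and>
    \<Phi> 1 = id \<and>
    (\<forall>c c'. \<Phi> (c * c') = \<Phi> c \<circ> \<Phi> c') \<and>
    (\<forall>X. continuous_on UNIV (\<lambda>c. \<Phi> c X)) \<and>
    (\<forall>X. \<Phi> x0 X = x0 * X) \<and>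
    (\<forall>X. \<Phi> x1 X = x1 * X + x0 * shuffle d X)"

text \<open>There is exactly one such map, so the definite description below is meaningful.\<close>

lemma coeff_simps [simp]:
  "coeff 0 w = 0" "coeff (s + t) w = coeff s w + coeff t w" "coeff (ncscale r s) w = r * coeff s w"
  by (simp_all add: zero_ncseries.rep_eq plus_ncseries.rep_eq ncscale.rep_eq)

lemma linear_ncscaleI:
  assumes "\<And>s t. f (s + t) = f s + f t" "\<And>r s. f (ncscale r s) = ncscale r (f s)"
  shows "Vector_Spaces.linear ncscale ncscale f"
  unfolding Vector_Spaces.linear_def module_hom_def module_hom_axioms_def
  using assms ncs.vector_space_axioms ncs.module_axioms by blast

lemma coeff_letter_mult:
  "coeff (word [a] * s) w = (case w of [] \<Rightarrow> 0 | b # v \<Rightarrow> if b = a then coeff s v else 0)"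
proof -
  have "coeff (word [a] * s) w = (\<Sum>(u, v) \<in> {(u, v). u @ v = w}. if u = [a] then coeff s v else 0)"
    by (simp add: times_ncseries.rep_eq word.rep_eq) (intro sum.cong, auto)
  also have "\<dots> = (\<Sum>(u, v) \<in> {(u, v). u @ v = w \<and> u = [a]}. coeff s v)"
    by (rule sum.mono_neutral_cong_right) (auto simp: finite_splits split: if_splits)
  also have "\<dots> = (case w of [] \<Rightarrow> 0 | b # v \<Rightarrow> if b = a then coeff s v else 0)"
  proof (cases w)
    case (Cons b v)
    then have "{(u, v). u @ v = w \<and> u = [a]} = (if b = a then {([a], v)} else {})"
      by auto
    with Cons show ?thesis by simp
  next
    case Nil
    then have "{(u, v). u @ v = w \<and> u = [a]} = {}" by auto
    with Nil show ?thesis by (simp only: sum.empty list.case)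
  qed
  finally show ?thesis .
qed

lemma word_Cons: "word (a # u) = (word [a] * word u :: 'k::field ncseries)"
  by (rule ncseries_eqI) (auto simp: coeff_letter_mult word.rep_eq split: list.splits)

fun letter_op :: "'k::field ncseries \<Rightarrow> letter \<Rightarrow> 'k ncseries \<Rightarrow> 'k ncseries" where
  "letter_op d X0 X = x0 * X"
| "letter_op d X1 X = x1 * X + x0 * shuffle d X"

definition word_op :: "'k::field ncseries \<Rightarrow> letter list \<Rightarrow> 'k ncseries \<Rightarrow> 'k ncseries" where
  "word_op d w = foldr (letter_op d) w"

lemma word_op_simps [simp]:
  "word_op d [] X = X" "word_op d (a # u) X = letter_op d a (word_op d u X)"
  "word_op d (u @ v) X = word_op d u (word_op d v X)"
  by (simp_all add: word_op_def)

lemma shuffle_add_right: "shuffle d (X + Y) = shuffle d X + shuffle d (Y :: 'k::field ncseries)"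
  by (rule ncseries_eqI)
     (simp add: shuffle.rep_eq sum.distrib[symmetric] case_prod_unfold algebra_simps)

lemma shuffle_scale_right: "shuffle d (ncscale r X) = ncscale r (shuffle d X)"
  by (rule ncseries_eqI)
     (simp add: shuffle.rep_eq sum_distrib_left case_prod_unfold algebra_simps)

lemma mult_scale_right: "s * ncscale r t = ncscale r (s * t)"
  by (rule ncseries_eqI)
     (simp add: times_ncseries.rep_eq sum_distrib_left case_prod_unfold algebra_simps)

lemma letter_op_add: "letter_op d a (X + Y) = letter_op d a X + letter_op d a Y"
  by (cases a) (simp_all add: shuffle_add_right algebra_simps)

lemma letter_op_scale: "letter_op d a (ncscale r X) = ncscale r (letter_op d a X)"
  by (cases a) (simp_all add: shuffle_scale_right mult_scale_right ncs.scale_right_distrib)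

lemma word_op_add: "word_op d u (X + Y) = word_op d u X + word_op d u Y"
  by (induction u) (simp_all add: letter_op_add)

lemma word_op_scale: "word_op d u (ncscale r X) = ncscale r (word_op d u X)"
  by (induction u) (simp_all add: letter_op_scale)

lemma word_op_zero: "word_op d u 0 = 0"
  using word_op_scale[of d u 0 0] by simp

lemma word_op_sum: "word_op d u (\<Sum>i\<in>A. ncscale (r i) (X i)) = (\<Sum>i\<in>A. ncscale (r i) (word_op d u (X i)))"
  by (induction A rule: infinite_finite_induct)
     (simp_all add: word_op_add word_op_scale word_op_zero)

lemma coeff_sum: "coeff (\<Sum>i\<in>A. X i) w = (\<Sum>i\<in>A. coeff (X i) w)"
  by (induction A rule: infinite_finite_induct) simp_all

lemma coeff_shuffle_cong:
  assumes "\<And>v. length v \<le> length w \<Longrightarrow> coeff X v = coeff Y v"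
  shows "coeff (shuffle d X) w = coeff (shuffle d Y) w"
  unfolding shuffle.rep_eq
proof (intro sum.cong refl, safe)
  fix u v assume "w \<in># word_shuffle u v"
  then have "length v \<le> length w" by (simp add: length_word_shuffle)
  then show "of_nat (count (word_shuffle u v) w) * (coeff d u * coeff X v) =
      of_nat (count (word_shuffle u v) w) * (coeff d u * coeff Y v)"
    by (simp add: assms)
qed

lemma coeff_letter_op_cong:
  assumes "\<And>v. length v < length w \<Longrightarrow> coeff X v = coeff Y v"
  shows "coeff (letter_op d a X) w = coeff (letter_op d a Y) w"
proof (cases w)
  case Nil
  then show ?thesis by (cases a) (simp_all add: coeff_letter_mult)
next
  case (Cons b v)
  have "coeff X v = coeff Y v" "coeff (shuffle d X) v = coeff (shuffle d Y) v"
    by (use assms Cons in \<open>auto intro!: coeff_shuffle_cong\<close>)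
  then show ?thesis
    by (cases a) (simp_all add: coeff_letter_mult Cons)
qed

lemma coeff_word_op_cong:
  assumes "\<And>v. length v + length u \<le> length w \<Longrightarrow> coeff X v = coeff Y v"
  shows "coeff (word_op d u X) w = coeff (word_op d u Y) w"
  using assms
proof (induction u arbitrary: w)
  case (Cons a u)
  show ?case
    unfolding word_op_simps
    by (rule coeff_letter_op_cong, rule Cons.IH, rule Cons.prems) simp
qed simp

lemma coeff_word_op_short:
  assumes "length w < length u"
  shows "coeff (word_op d u X) w = 0"
  using coeff_word_op_cong[of u w X 0 d] assms by (simp add: word_op_zero)

definition words_upto :: "nat \<Rightarrow> letter list set" where
  "words_upto n = {u. length u \<le> n}"

lemma mem_words_upto [simp]: "u \<in> words_upto n \<longleftrightarrow> length u \<le> n"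
  by (simp add: words_upto_def)

lemma finite_words_upto [simp]: "finite (words_upto n)"
  using finite_lists_length_le[of "UNIV :: letter set" n] by (simp add: words_upto_def)

definition Phi :: "'k::field ncseries \<Rightarrow> 'k ncseries \<Rightarrow> 'k ncseries \<Rightarrow> 'k ncseries" where
  "Phi d c X = Abs_ncseries (\<lambda>w. \<Sum>u\<in>words_upto (length w). coeff c u * coeff (word_op d u X) w)"

lemma coeff_Phi:
  "coeff (Phi d c X) w = (\<Sum>u\<in>words_upto (length w). coeff c u * coeff (word_op d u X) w)"
  by (simp add: Phi_def Abs_ncseries_inverse)

lemma coeff_Phi_ge:
  assumes "length w \<le> n"
  shows "coeff (Phi d c X) w = (\<Sum>u\<in>words_upto n. coeff c u * coeff (word_op d u X) w)"
  unfolding coeff_Phi using assms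
  by (intro sum.mono_neutral_left) (auto simp: coeff_word_op_short)

lemma Phi_word: "Phi d (word v) X = word_op d v X"
proof (rule ncseries_eqI)
  fix w
  have "coeff (Phi d (word v) X) w =
      (\<Sum>u\<in>words_upto (length w + length v). if u = v then coeff (word_op d u X) w else 0)"
    by (subst coeff_Phi_ge[of _ "length w + length v"], simp) (intro sum.cong, auto simp: word.rep_eq)
  then show "coeff (Phi d (word v) X) w = coeff (word_op d v X) w"
    by (simp only: sum.delta' sum.delta finite_words_upto mem_words_upto) simp
qed

lemma Phi_add: "Phi d (c + c') X = Phi d c X + Phi d c' X"
  by (rule ncseries_eqI) (simp add: coeff_Phi sum.distrib algebra_simps)

lemma Phi_scale: "Phi d (ncscale r c) X = ncscale r (Phi d c X)"
  by (rule ncseries_eqI) (simp add: coeff_Phi sum_distrib_left algebra_simps)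

lemma Phi_add_right: "Phi d c (X + Y) = Phi d c X + Phi d c Y"
  by (rule ncseries_eqI) (simp add: coeff_Phi word_op_add sum.distrib algebra_simps)

lemma Phi_scale_right: "Phi d c (ncscale r X) = ncscale r (Phi d c X)"
  by (rule ncseries_eqI) (simp add: coeff_Phi word_op_scale sum_distrib_left algebra_simps)

lemma Phi_mult: "Phi d (c * c') X = Phi d c (Phi d c' X)"
proof (rule ncseries_eqI)
  fix w :: "letter list"
  let ?n = "length w"
  have "coeff (Phi d c (Phi d c' X)) w =
      (\<Sum>u\<in>words_upto ?n. coeff c u * coeff (word_op d u (Phi d c' X)) w)"
    by (rule coeff_Phi)
  also have "\<dots> = (\<Sum>u\<in>words_upto ?n. \<Sum>v\<in>words_upto ?n.
      coeff c u * (coeff c' v * coeff (word_op d (u @ v) X) w))"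
  proof (rule sum.cong[OF refl])
    fix u
    have "coeff (word_op d u (Phi d c' X)) w =
        coeff (word_op d u (\<Sum>v\<in>words_upto ?n. ncscale (coeff c' v) (word_op d v X))) w"
      by (rule coeff_word_op_cong) (simp add: coeff_sum coeff_Phi_ge)
    then show "coeff c u * coeff (word_op d u (Phi d c' X)) w =
        (\<Sum>v\<in>words_upto ?n. coeff c u * (coeff c' v * coeff (word_op d (u @ v) X) w))"
      by (simp add: word_op_sum coeff_sum sum_distrib_left)
  qed
  also have "\<dots> = (\<Sum>(u, v)\<in>words_upto ?n \<times> words_upto ?n.
      coeff c u * (coeff c' v * coeff (word_op d (u @ v) X) w))"
    by (rule sum.cartesian_product)
  also have "\<dots> = (\<Sum>(u, v)\<in>{(u, v). length u + length v \<le> ?n}.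
      coeff c u * (coeff c' v * coeff (word_op d (u @ v) X) w))"
  proof (rule sum.mono_neutral_right)
    show "\<forall>i\<in>words_upto ?n \<times> words_upto ?n - {(u, v). length u + length v \<le> ?n}.
        (case i of (u, v) \<Rightarrow> coeff c u * (coeff c' v * coeff (word_op d (u @ v) X) w)) = 0"
    proof
      fix i assume i: "i \<in> words_upto ?n \<times> words_upto ?n - {(u, v). length u + length v \<le> ?n}"
      obtain u v where uv: "i = (u, v)" by fastforce
      with i have "coeff (word_op d (u @ v) X) w = 0"
        by (intro coeff_word_op_short) simp
      then show "(case i of (u, v) \<Rightarrow> coeff c u * (coeff c' v * coeff (word_op d (u @ v) X) w)) = 0"
        by (simp add: uv del: word_op_simps)
    qed
  qed auto
  also have "\<dots> = (\<Sum>(t, u, v)\<in>(SIGMA t:words_upto ?n. {(u, v). u @ v = t}).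
      coeff c u * coeff c' v * coeff (word_op d t X) w)"
    by (rule sum.reindex_bij_witness[where j = "\<lambda>(u, v). (u @ v, u, v)" and i = snd])
       (auto simp: mult.assoc)
  also have "\<dots> = (\<Sum>t\<in>words_upto ?n. \<Sum>(u, v)\<in>{(u, v). u @ v = t}.
      coeff c u * coeff c' v * coeff (word_op d t X) w)"
    by (subst sum.Sigma) (auto simp: finite_splits[unfolded case_prod_unfold] case_prod_unfold)
  also have "\<dots> = coeff (Phi d (c * c') X) w"
    by (simp add: coeff_Phi times_ncseries.rep_eq sum_distrib_right case_prod_unfold)
  finally show "coeff (Phi d (c * c') X) w = coeff (Phi d c (Phi d c' X)) w" ..
qed

lemma ex_inverse_power_less: "e > 0 \<Longrightarrow> \<exists>n. inverse (2 ^ n) < (e :: real)"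
  using real_arch_pow_inv[of e "1/2"] by (auto simp: power_divide inverse_eq_divide)

lemma continuous_Phi: "continuous_on UNIV (\<lambda>c. Phi d c X)"
  unfolding continuous_on_def
proof (intro ballI tendstoI)
  fix c and e :: real assume "0 < e"
  then obtain n where n: "inverse (2 ^ n) < e" using ex_inverse_power_less by blast
  have "dist (Phi d c' X) (Phi d c X) < e" if "dist c' c < inverse (2 ^ n)" for c'
  proof -
    have "dist (Phi d c' X) (Phi d c X) < inverse (2 ^ n)"
      using that unfolding dist_ncseries_less_iff coeff_Phi
      by (intro allI impI sum.cong) auto
    with n show ?thesis by simp
  qed
  then show "\<forall>\<^sub>F c' in at c. dist (Phi d c' X) (Phi d c X) < e"
    unfolding eventually_at by (intro exI[of _ "inverse (2 ^ n)"]) auto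
qed

lemma is_phi_Phi: "is_phi d (Phi d)"
  unfolding is_phi_def
  by (auto simp: fun_eq_iff one_ncseries_def Phi_word Phi_mult continuous_Phi Phi_add Phi_scale
        Phi_add_right Phi_scale_right intro!: linear_ncscaleI)

definition ncseries_trunc :: "nat \<Rightarrow> 'k::field ncseries \<Rightarrow> 'k ncseries" where
  "ncseries_trunc n c = (\<Sum>u\<in>words_upto n. ncscale (coeff c u) (word u))"

lemma ncseries_trunc_tendsto: "(\<lambda>n. ncseries_trunc n c) \<longlonglongrightarrow> c"
proof (rule metric_LIMSEQ_I)
  fix e :: real assume "0 < e"
  then obtain N where N: "inverse (2 ^ N) < e" using ex_inverse_power_less by blast
  have "dist (ncseries_trunc n c) c < e" if "n \<ge> N" for n
  proof -
    have "coeff (ncseries_trunc n c) w = coeff c w" if "length w \<le> n" for w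
    proof -
      have "coeff (ncseries_trunc n c) w = (\<Sum>u\<in>words_upto n. if u = w then coeff c u else 0)"
        unfolding ncseries_trunc_def coeff_sum by (intro sum.cong) (auto simp: word.rep_eq)
      then show ?thesis using that
        by simp
    qed
    then have "dist (ncseries_trunc n c) c < inverse (2 ^ N)"
      unfolding dist_ncseries_less_iff using \<open>n \<ge> N\<close> by simp
    with N show ?thesis by simp
  qed
  then show "\<exists>N. \<forall>n\<ge>N. dist (ncseries_trunc n c) c < e" by blast
qed

lemma is_phi_word:
  assumes "is_phi d \<Phi>"
  shows "\<Phi> (word u) X = word_op d u X"
proof (induction u arbitrary: X)
  case Nil
  then show ?case using assms by (simp add: is_phi_def one_ncseries_def)
next
  case (Cons a u)
  have "\<Phi> (word (a # u)) X = \<Phi> (word [a]) (\<Phi> (word u) X)"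
    using assms unfolding is_phi_def by (subst word_Cons) simp
  also have "\<dots> = letter_op d a (\<Phi> (word u) X)"
    using assms by (cases a) (simp_all add: is_phi_def)
  finally show ?case by (simp add: Cons.IH)
qed

lemma is_phi_unique:
  assumes "is_phi d \<Phi>" "is_phi d \<Psi>"
  shows "\<Phi> = \<Psi>"
proof (intro ext)
  fix c X
  have trunc: "F (ncseries_trunc n c) X = (\<Sum>u\<in>words_upto n. ncscale (coeff c u) (word_op d u X))"
    if "is_phi d F" for F n
  proof -
    interpret L: Vector_Spaces.linear ncscale ncscale "\<lambda>c. F c X"
      using that by (simp add: is_phi_def)
    show ?thesis
      by (simp add: ncseries_trunc_def L.sum L.scale is_phi_word[OF that])
  qed
  have lim: "(\<lambda>n. F (ncseries_trunc n c) X) \<longlonglongrightarrow> F c X" if "is_phi d F" for F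
    by (rule continuous_on_tendsto_compose[OF _ ncseries_trunc_tendsto])
       (use that in \<open>auto simp: is_phi_def\<close>)
  show "\<Phi> c X = \<Psi> c X"
    using lim[OF assms(1)] lim[OF assms(2)] LIMSEQ_unique
    by (simp add: trunc[OF assms(1)] trunc[OF assms(2)])
qed

definition phi :: "'k::field ncseries \<Rightarrow> 'k ncseries \<Rightarrow> 'k ncseries \<Rightarrow> 'k ncseries" where
  "phi d = (THE \<Phi>. is_phi d \<Phi>)"

lemma is_phi_phi: "is_phi d (phi d)"
  unfolding phi_def by (rule theI[of _ "Phi d"]) (auto intro: is_phi_Phi is_phi_unique)

definition fcomp :: "'k::field ncseries \<Rightarrow> 'k ncseries \<Rightarrow> 'k ncseries" where
  "fcomp c d = phi d c 1 + d"

definition fcomp_tilde :: "'k::field ncseries \<Rightarrow> 'k ncseries \<Rightarrow> 'k ncseries" (infixl \<open>\<circ>~\<close> 70) where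
  "c \<circ>~ d = fcomp c d - d"

end

theory Submission
  imports Defs
begin

text \<open>Multiplicativity of \<open>phi d\<close> turns a word into the composite of its letters'
  operators, here evaluated at the unit \<open>word []\<close>; the \<open>d\<close> added in
  \<open>fcomp\<close> cancels.\<close>

lemma fcomp_tilde_word: "word u \<circ>~ d = word_op d u (word [])"
  by (simp add: fcomp_tilde_def fcomp_def is_phi_word[OF is_phi_phi] one_ncseries_def)

theorem lemma2:
  fixes c :: "letter list" and d :: "'k::field_char_0 ncseries"
  shows "word [] \<circ>~ d = word [] \<and>
    word (X0 # c) \<circ>~ d = x0 * (word c \<circ>~ d) \<and>
    word (X1 # c) \<circ>~ d = x1 * (word c \<circ>~ d) + x0 * shuffle d (word c \<circ>~ d)"
  \<comment> \<open>The first letter of a word acts last, so \<open>word_op\<close> on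
    \<open>a # c\<close> is \<open>letter_op d a\<close> after \<open>word_op\<close> on
    \<open>c\<close>. The two cases of \<open>letter_op\<close> are the two recursions; the empty
    composite is the identity.\<close>
  by (simp add: fcomp_tilde_word)

end
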